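(* Let $k\ge 2$, $n\ge 2$, and $2\le m\le|\mathbf{R}_k(n)|$. Let $\alpha_1,\alpha_2,\ldots,\alpha_m$ be the last $m$ strings of $\mathbf{R}_k(n)$ when it is listed in reverse lexicographic order. Then $\text{UC}(\alpha_1,\ldots,\alpha_m)=pr(\alpha_1)pr(\alpha_2)\cdots pr(\alpha_m)$ is a universal cycle for $\mathbf{S}=\bigcup_{i=1}^m\mathbf{sub}_n(\alpha_i)$.
   Context: $\Sigma_k=\{0,1,\ldots,k-1\}$ with the natural order; $\Sigma_k^n$ is the set of strings of length $n$ over $\Sigma_k$. A necklace is a string that is lexicographically smallest among all its rotations; $\mathbf{Neck}_k(n)$ is the set of $k$-ary necklaces of length $n$. $\mathbf{R}_k(n)$ is the set of all $\alpha=a_1\cdots a_n\in\Sigma_k^n$ such that $a_{i+1}a_{i+2}\cdots a_na_1\cdots a_i\in\mathbf{Neck}_k(n)$, where $i$ is the largest index with $a_i\ne 0$; in addition $0^n\in\mathbf{R}_k(n)$ (e.g. $\mathbf{R}_2(5)=\{11111,11110,10110,11100,10100,11000,10000,00000\}$). Lexicographic order on strings of equal length: $a_1\cdots a_n$ precedes $b_1\cdots b_n$ if $a_i<b_i$ at the smallest $i$ with $a_i\ne b_i$; reverse lexicographic order is the reverse of this order. The periodic reduction $pr(a_1\cdots a_n)$ is $a_1\cdots a_p$ where $p$ is the smallest integer with $a_1\cdots a_n=(a_1\cdots a_p)^{n/p}$. For a string $\alpha$, $\mathbf{sub}_n(\alpha)$ is the set of all length-$n$ substrings of $\alpha$ viewed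 as a cyclic string (windows may wrap around). For a nonempty $\mathbf{S}\subseteq\Sigma_k^n$, a universal cycle for $\mathbf{S}$ is a string of length $|\mathbf{S}|$ which, viewed cyclically, contains every string of $\mathbf{S}$ as a length-$n$ substring exactly once.
   Formalization: In R_k(n), a nonzero string is also required to begin with a nonzero letter; the literal definition would admit e.g. 01111 in R_2(5), against the listed example, and makes the claim false (k=n=2, m=3: 10010 has length 5 but |S|=3). *)

theory Defs
  imports Main "HOL-Library.List_Lexorder"
begin

definition strings :: "nat \<Rightarrow> nat \<Rightarrow> nat list set" where
  "strings k n = {\<alpha>. length \<alpha> = n \<and> set \<alpha> \<subseteq> {..<k}}"

definition Neck :: "nat \<Rightarrow> nat \<Rightarrow> nat list set" where
  "Neck k n = {\<alpha> \<in> strings k n. \<forall>i. \<alpha> \<le> rotate i \<alpha>}"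

text \<open>Indices of a string are counted from 1; meaningful only if some letter is nonzero.\<close>

definition last_nonzero :: "nat list \<Rightarrow> nat" where
  "last_nonzero \<alpha> = Max {i. 1 \<le> i \<and> i \<le> length \<alpha> \<and> \<alpha> ! (i - 1) \<noteq> 0}"

text \<open>The condition that the first letter is nonzero is needed to get exactly one representative per
  necklace class, as in the example for \<open>k = 2\<close>, \<open>n = 5\<close> below: the string \<open>01111\<close>, with
  last nonzero index 5, is itself a necklace but is not a member.\<close>

definition R :: "nat \<Rightarrow> nat \<Rightarrow> nat list set" where
  "R k n = insert (replicate n 0)
     {\<alpha> \<in> strings k n. \<alpha> \<noteq> [] \<and> hd \<alpha> \<noteq> 0 \<and> rotate (last_nonzero \<alpha>) \<alpha> \<in> Neck k n}"

lemma last_nonzero_eq: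
  assumes "\<alpha> \<noteq> []" "hd \<alpha> \<noteq> 0"
  shows "last_nonzero \<alpha> = length (dropWhile (\<lambda>a. a = 0) (rev \<alpha>))"
proof -
  have "last_nonzero \<alpha> = length (dropWhile (\<lambda>a. a = 0) (rev \<alpha>))" if "\<exists>a\<in>set \<alpha>. a \<noteq> 0"
    using that
  proof (induction \<alpha> rule: rev_induct)
    case (snoc x xs)
    show ?case
    proof (cases "x = 0")
      case True
      then have "{i. 1 \<le> i \<and> i \<le> length (xs @ [x]) \<and> (xs @ [x]) ! (i - 1) \<noteq> 0}
          = {i. 1 \<le> i \<and> i \<le> length xs \<and> xs ! (i - 1) \<noteq> 0}"
        by (auto simp: nth_append le_Suc_eq split: if_splits)
      then show ?thesis
        using True snoc by (simp add: last_nonzero_def)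
    next
      case False
      then show ?thesis
        unfolding last_nonzero_def by (intro Max_eqI) auto
    qed
  qed simp
  moreover have "\<exists>a\<in>set \<alpha>. a \<noteq> 0"
    using assms hd_in_set by blast
  ultimately show ?thesis by blast
qed

lemma strings_eq: "strings k n = set (List.n_lists n [0..<k])"
  by (auto simp: strings_def set_n_lists)

lemma Neck_iff:
  "\<alpha> \<in> Neck k n \<longleftrightarrow> \<alpha> \<in> strings k n \<and> (\<forall>i\<in>set [0..<length \<alpha>]. \<alpha> \<le> rotate i \<alpha>)"
  (is "?l \<longleftrightarrow> ?r")
proof
  assume r: ?r
  have "\<alpha> \<le> rotate i \<alpha>" for i
  proof (cases "\<alpha> = []")
    case False
    then have "\<alpha> \<le> rotate (i mod length \<alpha>) \<alpha>"
      using r by simp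
    then show ?thesis
      by (simp only: rotate_conv_mod[symmetric])
  qed simp
  with r show ?l by (simp add: Neck_def)
qed (simp add: Neck_def)

lemma R_2_5:
  "R 2 5 = {[1,1,1,1,1], [1,1,1,1,0], [1,0,1,1,0], [1,1,1,0,0], [1,0,1,0,0], [1,1,0,0,0],
            [1,0,0,0,0], [0,0,0,0,0]}"
proof -
  define rot where "rot \<alpha> = rotate (length (dropWhile (\<lambda>a. a = 0) (rev \<alpha>))) \<alpha>" for \<alpha> :: "nat list"
  define P where "P \<alpha> \<longleftrightarrow> \<alpha> \<noteq> [] \<and> hd \<alpha> \<noteq> 0 \<and> (\<forall>i\<in>{0,1,2,3,4}. rot \<alpha> \<le> rotate i (rot \<alpha>))"
    for \<alpha> :: "nat list"
  have iv: "set [0..<5] = {0,1,2,3,4}"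
    by (auto simp: numeral_eq_Suc)
  have rot_s: "rot \<alpha> \<in> strings k n \<longleftrightarrow> \<alpha> \<in> strings k n" for \<alpha> k n
    by (simp add: rot_def strings_def)
  have lr: "length (rot \<alpha>) = length \<alpha>" for \<alpha>
    by (simp add: rot_def)
  have "rotate (last_nonzero \<alpha>) \<alpha> \<in> Neck 2 5 \<longleftrightarrow> (\<forall>i\<in>{0,1,2,3,4}. rot \<alpha> \<le> rotate i (rot \<alpha>))"
    if "\<alpha> \<in> strings 2 5" "\<alpha> \<noteq> []" "hd \<alpha> \<noteq> 0" for \<alpha>
  proof -
    have "length \<alpha> = 5" using that by (simp add: strings_def)
    then show ?thesis
      using that unfolding last_nonzero_eq[OF that(2,3)] rot_def[symmetric] Neck_iff rot_s lr
      by (simp only: iv simp_thms)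
  qed
  then have "R 2 5 = insert (replicate 5 0) {\<alpha> \<in> strings 2 5. P \<alpha>}"
    unfolding R_def P_def by blast
  also have "{\<alpha> \<in> strings 2 5. P \<alpha>} = set (filter P (List.n_lists 5 [0..<2]))"
    by (auto simp: strings_eq)
  also have "List.n_lists 5 [0..<2] =
    [[0,0,0,0,0], [1,0,0,0,0], [0,1,0,0,0], [1,1,0,0,0], [0,0,1,0,0], [1,0,1,0,0], [0,1,1,0,0], [1,1,1,0,0],
     [0,0,0,1,0], [1,0,0,1,0], [0,1,0,1,0], [1,1,0,1,0], [0,0,1,1,0], [1,0,1,1,0], [0,1,1,1,0], [1,1,1,1,0],
     [0,0,0,0,1], [1,0,0,0,1], [0,1,0,0,1], [1,1,0,0,1], [0,0,1,0,1], [1,0,1,0,1], [0,1,1,0,1], [1,1,1,0,1],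
     [0,0,0,1,1], [1,0,0,1,1], [0,1,0,1,1], [1,1,0,1,1], [0,0,1,1,1], [1,0,1,1,1], [0,1,1,1,1], [1,1,1,1,1]]"
    by (simp add: numeral_eq_Suc)
  also have "filter P \<dots> =
    [[1,0,0,0,0], [1,1,0,0,0], [1,0,1,0,0], [1,1,1,0,0], [1,0,1,1,0], [1,1,1,1,0], [1,1,1,1,1]]"
    by (simp add: P_def rot_def rotate_def numeral_eq_Suc)
  also have "replicate 5 0 = [0,0,0,0,0::nat]"
    by (simp add: numeral_eq_Suc)
  finally show ?thesis by (simp only: list.set insert_commute)
qed

definition period :: "'a list \<Rightarrow> nat" where
  "period \<alpha> = (LEAST p. p > 0 \<and> p dvd length \<alpha> \<and>
     \<alpha> = concat (replicate (length \<alpha> div p) (take p \<alpha>)))"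

definition pr :: "'a list \<Rightarrow> 'a list" where
  "pr \<alpha> = take (period \<alpha>) \<alpha>"

text \<open>The length-\<open>n\<close> window starting at (0-based) position \<open>i\<close> of the cyclic string \<open>\<alpha>\<close>;
  it may wrap around, more than once if \<open>n > length \<alpha>\<close>.\<close>

definition window :: "nat \<Rightarrow> 'a list \<Rightarrow> nat \<Rightarrow> 'a list" where
  "window n \<alpha> i = map (\<lambda>j. \<alpha> ! ((i + j) mod length \<alpha>)) [0..<n]"

definition sub :: "nat \<Rightarrow> 'a list \<Rightarrow> 'a list set" where
  "sub n \<alpha> = {window n \<alpha> i | i. i < length \<alpha>}"

definition universal_cycle :: "nat \<Rightarrow> nat \<Rightarrow> nat list set \<Rightarrow> nat list \<Rightarrow> bool" where
  "universal_cycle k n S u \<longleftrightarrow>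
     S \<noteq> {} \<and> S \<subseteq> strings k n \<and> length u = card S \<and>
     (\<forall>s \<in> S. \<exists>!i. i < length u \<and> window n u i = s)"

definition UC :: "'a list list \<Rightarrow> 'a list" where
  "UC \<alpha>s = concat (map pr \<alpha>s)"

definition revlex_list :: "nat list set \<Rightarrow> nat list list" where
  "revlex_list A = rev (sorted_list_of_set A)"

end

theory Submission
  imports Defs "HOL-Library.Sublist"
begin

text \<open>
  Write a nonzero representative as \<open>x = b c 0\<^sup>j\<close> with \<open>c \<noteq> 0\<close>. Its cyclic runs of zeros have length
  at most \<open>j\<close>, so extending the final run by overwriting the tail with zeros always yields another
  representative. Hence the successor of \<open>x\<close> in reverse lexicographic order still begins with \<open>b\<close>,
  and all rotations of \<open>x\<close> that do not start inside the final zeros occur where the block of \<open>x\<close>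
  meets the next blocks. A remaining rotation is \<open>0\<^sup>l q\<close> with \<open>q\<close> a prefix of \<open>x\<close>; it occurs at the
  beginning of the first block whose representative has prefix \<open>q\<close>, because the representative just
  before that one ends in \<open>0\<^sup>l\<close> (and, at the wrap-around, the whole string ends in \<open>0\<^sup>n\<close>). The
  length of the concatenation is the number of rotations, so each of them occurs exactly once.
\<close>

section \<open>Lexicographic order on strings of equal length\<close>

lemma append_less_append_iff:
  fixes u u' v v' :: "'a::linorder list"
  assumes "length u = length u'"
  shows "u @ v < u' @ v' \<longleftrightarrow> u < u' \<or> u = u' \<and> v < v'"
  using assms
proof (induction u u' rule: list_induct2)
  case (Cons x xs y ys)
  then show ?case by auto
qed simp

text \<open>A first difference between \<open>b\<close> and the first \<open>length b\<close>
  letters of \<open>y\<close> would already decide one of the two comparisons, and decide it the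
  wrong way.\<close>

lemma prefix_if_between:
  fixes b :: "'a::linorder list"
  assumes "b @ u \<le> y" "y \<le> b @ v" "length y = length b + r"
  shows "prefix b y"
proof -
  have y: "y = take (length b) y @ drop (length b) y" by simp
  have len: "length b = length (take (length b) y)" using assms(3) by simp
  have "\<not> take (length b) y < b"
    using assms(1) append_less_append_iff[OF len[symmetric], of "drop (length b) y" u] y
    by (metis not_le)
  moreover have "\<not> b < take (length b) y"
    using assms(2) append_less_append_iff[OF len, of v "drop (length b) y"] y
    by (metis not_le)
  ultimately have "b = take (length b) y" by force
  then show ?thesis by (metis take_is_prefix)
qed

text \<open>The first nonzero letter of \<open>w\<close> stands at position \<open>t\<close> or
  earlier, where the left side still has a zero. All comparisons with a necklace below go through
  this fact.\<close>

lemma zeros_append_less: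
  fixes v w :: "nat list"
  assumes "t < j" "w ! t \<noteq> 0" "t < length w"
  shows "replicate j 0 @ v < w"
  using assms
proof (induction j arbitrary: t w)
  case (Suc j)
  then obtain a w' where w: "w = a # w'" by (cases w) auto
  show ?case
  proof (cases "a = 0")
    case True
    then obtain t' where "t = Suc t'" using Suc.prems w by (cases t) auto
    then show ?thesis using Suc w True by auto
  qed (use w in auto)
qed simp

section \<open>Periods and rotations\<close>

text \<open>Commuting forces \<open>b\<close> to start with \<open>a\<close>; cancelling that copy
  leaves a shorter string that still commutes with \<open>a\<close>.\<close>

lemma concat_replicate_if_commute:
  assumes "a @ b = b @ a" "length b = s * length a"
  shows "b = concat (replicate s a)"
  using assms
proof (induction s arbitrary: b)
  case (Suc s)
  then have "take (length a) (a @ b) = take (length a) b" by simp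
  then have "b = a @ drop (length a) b" by (metis append_eq_conv_conj append_take_drop_id)
  then obtain c where c: "b = a @ c" ..
  with Suc show ?case by simp
qed simp

lemma concat_replicate_if_rotate:
  assumes "rotate g x = x" "g dvd length x" "0 < g" "x \<noteq> []"
  shows "x = concat (replicate (length x div g) (take g x))"
proof -
  obtain r where r: "length x = g * r" using assms(2) by auto
  with assms(4) obtain s where s: "r = Suc s" by (cases r) auto
  have "drop g x = concat (replicate s (take g x))"
  proof (rule concat_replicate_if_commute)
    show "take g x @ drop g x = drop g x @ take g x"
    proof (cases "g = length x")
      case False
      with r s have "g < length x" by auto
      with assms(1) show ?thesis by (simp add: rotate_drop_take)
    qed simp
    show "length (drop g x) = s * length (take g x)" using r s by simp
  qed
  then have "x = take g x @ concat (replicate s (take g x))" by (metis append_take_drop_id)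
  then show ?thesis using r s assms(3) by simp
qed

lemma period_props:
  assumes "x \<noteq> []"
  shows "0 < period x" "period x dvd length x"
    "x = concat (replicate (length x div period x) (pr x))"
proof -
  let ?P = "\<lambda>p. p > 0 \<and> p dvd length x \<and> x = concat (replicate (length x div p) (take p x))"
  have "?P (length x)" using assms by simp
  then have "?P (period x)" unfolding period_def by (rule LeastI)
  then show "0 < period x" "period x dvd length x"
    "x = concat (replicate (length x div period x) (pr x))" by (auto simp: pr_def)
qed

lemma period_le_if_rotate:
  assumes "rotate g x = x" "g dvd length x" "0 < g" "x \<noteq> []"
  shows "period x \<le> g"
  unfolding period_def using concat_replicate_if_rotate[OF assms] assms by (intro Least_le) auto

lemma period_le_length: "x \<noteq> [] \<Longrightarrow> period x \<le> length x"
  by (simp add: dvd_imp_le period_props(2))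

lemma length_pr: "x \<noteq> [] \<Longrightarrow> length (pr x) = period x"
  using period_le_length[of x] by (simp add: pr_def)

lemma rotate_concat_replicate:
  "rotate (length z) (concat (replicate r z)) = concat (replicate r z)"
proof (cases r)
  case (Suc s)
  have "concat (replicate s z) @ z = z @ concat (replicate s z)"
    by (induction s) auto
  then show ?thesis using Suc by (simp add: rotate_append)
qed simp

lemma rotate_period:
  assumes "x \<noteq> []"
  shows "rotate (period x) x = x"
  using rotate_concat_replicate[of "pr x" "length x div period x"]
  unfolding length_pr[OF assms] period_props(3)[OF assms, symmetric] .

lemma rotate_mult_eq:
  assumes "rotate p x = x"
  shows "rotate (q * p) x = x"
proof (induction q)
  case (Suc q)
  have "rotate (Suc q * p) x = rotate (q * p) (rotate p x)"
    by (simp only: rotate_rotate mult_Suc add.commute)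
  then show ?case using Suc assms by simp
qed simp

lemma rotate_mod_eq:
  assumes "rotate p x = x"
  shows "rotate (i mod p) x = rotate i x"
proof -
  have "rotate i x = rotate (i mod p) (rotate (i div p * p) x)"
    by (simp add: rotate_rotate)
  then show ?thesis by (simp add: rotate_mult_eq[OF assms])
qed

lemma rotate_inject:
  fixes x y :: "'a list"
  assumes "rotate i x = rotate i y"
  shows "x = y"
proof -
  have "inj (rotate i :: 'a list \<Rightarrow> 'a list)"
    unfolding rotate_def by (rule inj_fn[OF inj_rotate1])
  then show ?thesis using assms by (simp add: inj_eq)
qed

lemma rotate_cancel:
  assumes "rotate i x = rotate i' x" "i \<le> i'"
  shows "rotate (i' - i) x = x"
  by (rule rotate_inject[of i]) (use assms in \<open>simp add: rotate_rotate\<close>)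

text \<open>Strings with a common rotation have the same rotations.\<close>

lemma rotate_conjugate:
  assumes "rotate i x = rotate i' y"
  shows "\<exists>s. rotate s x = rotate t y"
proof (cases "y = []")
  case False
  \<comment> \<open>Rotation by \<open>i'\<close> is undone by completing it to a multiple of the
    length, namely \<open>i' * length y\<close>.\<close>
  then have "i' \<le> i' * length y" by (cases y) auto
  then have y: "rotate (i' * length y - i') (rotate i' y) = y"
    by (simp add: rotate_rotate)
  have "rotate (t + (i' * length y - i' + i)) x = rotate t (rotate (i' * length y - i') (rotate i x))"
    by (simp add: rotate_rotate)
  also have "\<dots> = rotate t y" unfolding assms y ..
  finally show ?thesis by blast
next
  case True
  then show ?thesis using assms by simp
qed

text \<open>\<open>period\<close> is a minimum over divisors of the length only. The least positive
  \<open>g\<close> that fixes \<open>x\<close> is such a divisor, because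
  \<open>length x mod g\<close> fixes \<open>x\<close> as well and is smaller than
  \<open>g\<close>.\<close>

lemma rotate_eq_imp_ge_period:
  assumes "rotate d x = x" "0 < d" "x \<noteq> []"
  shows "period x \<le> d"
proof -
  define g where "g = (LEAST g. 0 < g \<and> rotate g x = x)"
  have g: "0 < g \<and> rotate g x = x"
    unfolding g_def using LeastI[of "\<lambda>g. 0 < g \<and> rotate g x = x" d] assms(1,2) by blast
  have "g \<le> d" unfolding g_def using assms(1,2) by (simp add: Least_le)
  have "rotate (length x mod g) x = x"
    using rotate_mod_eq[of g x "length x"] g by simp
  moreover have "length x mod g < g" using g by simp
  ultimately have "\<not> 0 < length x mod g"
    using not_less_Least[of "length x mod g" "\<lambda>g. 0 < g \<and> rotate g x = x"]
    unfolding g_def[symmetric] by simp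
  then have "period x \<le> g" using g assms by (intro period_le_if_rotate) auto
  with \<open>g \<le> d\<close> show ?thesis by simp
qed

section \<open>Windows of a string as its rotations, and their number\<close>

lemma window_eq_rotate: "length x = n \<Longrightarrow> window n x i = rotate i x"
  unfolding window_def by (intro nth_equalityI) (auto simp: nth_rotate add.commute)

lemma sub_eq_rotations:
  assumes "length x = n" "x \<noteq> []"
  shows "sub n x = (\<lambda>i. rotate i x) ` {..<period x}"
proof -
  have "rotate i x \<in> (\<lambda>i. rotate i x) ` {..<period x}" for i
    using rotate_mod_eq[OF rotate_period[OF assms(2)], of i] period_props(1)[OF assms(2)]
    by (intro image_eqI[where x = "i mod period x"]) auto
  moreover have "i < period x \<Longrightarrow> i < length x" for i
    using period_le_length[OF assms(2)] by simp
  ultimately show ?thesis unfolding sub_def window_eq_rotate[OF assms(1)] by auto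
qed

text \<open>Two equal rotations differ by a shift that fixes \<open>x\<close>, and a positive shift
  of this kind is at least the period.\<close>

lemma card_sub:
  assumes "length x = n" "x \<noteq> []"
  shows "card (sub n x) = period x"
proof -
  have aux: "i = i'" if "rotate i x = rotate i' x" "i \<le> i'" "i' < period x" for i i'
    using rotate_eq_imp_ge_period[OF rotate_cancel[OF that(1,2)] _ assms(2)] that(2,3) by linarith
  have "inj_on (\<lambda>i. rotate i x) {..<period x}"
  proof (rule inj_onI)
    fix i i' assume "i \<in> {..<period x}" "i' \<in> {..<period x}" "rotate i x = rotate i' x"
    then show "i = i'" using aux[of i i'] aux[of i' i] by (cases "i \<le> i'") auto
  qed
  then show ?thesis by (simp add: sub_eq_rotations[OF assms] card_image)
qed

section \<open>The strings in \<open>R\<close>\<close>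

lemma trailing_zeros_decomp:
  fixes e :: "nat list"
  assumes "e \<noteq> []" "hd e \<noteq> 0"
  obtains b j where "e = b @ replicate j 0" "b \<noteq> []" "hd b \<noteq> 0" "last b \<noteq> 0"
proof -
  have "\<exists>b j. e = b @ replicate j 0 \<and> b \<noteq> [] \<and> hd b \<noteq> 0 \<and> last b \<noteq> 0"
    using assms
  proof (induction e rule: rev_induct)
    case (snoc x xs)
    show ?case
    proof (cases "x = 0 \<and> xs \<noteq> []")
      case True
      then obtain b j where "xs = b @ replicate j 0" "b \<noteq> []" "hd b \<noteq> 0" "last b \<noteq> 0"
        using snoc by auto
      then show ?thesis using True
        by (intro exI[of _ b] exI[of _ "Suc j"]) (auto simp: replicate_append_same)
    next
      case False
      then show ?thesis using snoc
        by (intro exI[of _ "xs @ [x]"] exI[of _ 0]) (auto simp: hd_append)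
    qed
  qed simp
  then show ?thesis using that by blast
qed

lemma last_nonzero_append_zeros:
  assumes "b \<noteq> []" "hd b \<noteq> 0" "last b \<noteq> 0"
  shows "last_nonzero (b @ replicate j 0) = length b"
proof -
  have "dropWhile (\<lambda>a. a = 0) (rev b) = rev b"
    using assms by (simp add: dropWhile_eq_self_iff hd_rev)
  moreover have "dropWhile (\<lambda>a. a = 0) (replicate j 0 @ rev b) = dropWhile (\<lambda>a. a = 0) (rev b)"
    by (induction j) auto
  ultimately show ?thesis
    using assms by (subst last_nonzero_eq) auto
qed

text \<open>The necklace of \<open>b 0^j\<close> is \<open>0^j b\<close>. Both have the same
  rotations, so the necklace condition can be tested on the rotations of the representative
  itself.\<close>

lemma R_append_zeros_iff:
  assumes "b \<noteq> []" "hd b \<noteq> 0" "last b \<noteq> 0"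
  shows "b @ replicate j 0 \<in> R k n \<longleftrightarrow>
    b @ replicate j 0 \<in> strings k n \<and> (\<forall>i. replicate j 0 @ b \<le> rotate i (b @ replicate j 0))"
proof -
  have rot: "rotate (length b) (b @ replicate j 0) = replicate j 0 @ b" by (rule rotate_append)
  have rot': "rotate j (replicate j 0 @ b) = b @ replicate j 0"
    using rotate_append[of "replicate j 0" b] by simp
  have "b @ replicate j 0 \<noteq> replicate n 0"
    using assms(1,2) by (cases b; cases n) simp_all
  moreover have "replicate j 0 @ b \<in> strings k n \<longleftrightarrow> b @ replicate j 0 \<in> strings k n"
    by (auto simp: strings_def)
  moreover have "(\<forall>i. replicate j 0 @ b \<le> rotate i (b @ replicate j 0)) \<longleftrightarrow>
      (\<forall>i. replicate j 0 @ b \<le> rotate i (replicate j 0 @ b))"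
  proof -
    have "rotate i (b @ replicate j 0) = rotate (i + j) (replicate j 0 @ b)" for i
      unfolding rot'[symmetric] rotate_rotate ..
    moreover have "rotate i (replicate j 0 @ b) = rotate (i + length b) (b @ replicate j 0)" for i
      unfolding rot[symmetric] rotate_rotate ..
    ultimately show ?thesis by (metis (no_types))
  qed
  moreover have "hd (b @ replicate j 0) \<noteq> 0" using assms by simp
  ultimately show ?thesis
    using assms(1) unfolding R_def Neck_def by (simp add: last_nonzero_append_zeros[OF assms] rot)
qed

lemma R_strings: "2 \<le> k \<Longrightarrow> x \<in> R k n \<Longrightarrow> x \<in> strings k n"
  by (auto simp: R_def strings_def)

lemma R_cases: "x \<in> R k n \<Longrightarrow> x = replicate n 0 \<or> x \<noteq> [] \<and> hd x \<noteq> 0"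
  by (auto simp: R_def)

text \<open>A rotation starting with more than \<open>j\<close> zeros would be smaller than the
  necklace \<open>0^j b\<close>, whose letter at position \<open>j\<close> is nonzero.\<close>

lemma R_no_longer_zero_run:
  assumes "b @ replicate j 0 \<in> R k n" "b \<noteq> []" "hd b \<noteq> 0" "last b \<noteq> 0" "j < l" "i + l \<le> n"
  shows "\<exists>t<l. (b @ replicate j 0) ! (i + t) \<noteq> 0"
proof (rule ccontr)
  let ?e = "b @ replicate j 0"
  assume "\<not> ?thesis"
  then have z: "?e ! (i + t) = 0" if "t < l" for t using that by auto
  have len: "length ?e = n" and le: "replicate j 0 @ b \<le> rotate i ?e"
    using assms(1) unfolding R_append_zeros_iff[OF assms(2-4)] strings_def by auto
  have "take l (rotate i ?e) = replicate l 0"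
    using assms(6) len z by (intro nth_equalityI) (auto simp: nth_rotate add.commute)
  then have "rotate i ?e = replicate l 0 @ drop l (rotate i ?e)"
    by (metis append_take_drop_id)
  moreover have "replicate l 0 @ drop l (rotate i ?e) < replicate j 0 @ b"
    using assms by (intro zeros_append_less[of j]) (auto simp: nth_append hd_conv_nth)
  ultimately show False using le by simp
qed

text \<open>Lengthening the final run of zeros beyond its maximal length makes it the unique longest
  cyclic run of zeros, so the result is again a representative.\<close>

lemma R_overwrite_zeros:
  assumes k: "2 \<le> k" and e: "e \<in> R k n" "hd e \<noteq> 0" and l: "l < n" "drop (n - l) e \<noteq> replicate l 0"
  shows "take (n - l) e @ replicate l 0 \<in> R k n"
proof -
  have len: "length e = n" and es: "set e \<subseteq> {..<k}"
    using R_strings[OF k e(1)] by (auto simp: strings_def)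
  have ne: "e \<noteq> []" using len l by auto
  obtain b j where b: "e = b @ replicate j 0" "b \<noteq> []" "hd b \<noteq> 0" "last b \<noteq> 0"
    using trailing_zeros_decomp[OF ne e(2)] by blast
  have "j < l"
  proof (rule ccontr)
    assume "\<not> j < l"
    then have "drop (n - l) e = replicate l 0"
      using b(1) len by auto
    with l show False by simp
  qed
  let ?q = "take (n - l) e"
  have "?q \<noteq> []" "hd ?q \<noteq> 0" using l len e ne by auto
  \<comment> \<open>The kept part may itself end in \<open>i\<close> zeros, so the final run of the
    new string has length \<open>i + l\<close>, not \<open>l\<close>.\<close>
  then obtain c i where c: "?q = c @ replicate i 0" "c \<noteq> []" "hd c \<noteq> 0" "last c \<noteq> 0"
    using trailing_zeros_decomp by blast
  define j' where "j' = i + l"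
  define e' where "e' = c @ replicate j' 0"
  have e': "?q @ replicate l 0 = e'" by (simp add: e'_def j'_def c(1) replicate_add)
  have len': "length e' = n" using len l unfolding e'[symmetric] by simp
  have cn: "length c + j' = n" using len' by (simp add: e'_def)
  have "set e' \<subseteq> {..<k}" unfolding e'[symmetric] using es k by (auto dest: in_set_takeD)
  then have str: "e' \<in> strings k n" using len' by (simp add: strings_def)
  have nth_c: "e' ! t = e ! t" if "t < length c" for t
  proof -
    have "t < n - l" using that cn by (simp add: j'_def)
    then show ?thesis by (simp add: e'[symmetric] nth_append len)
  qed
  have "replicate j' 0 @ c \<le> rotate s e'" for s
  proof -
    define r where "r = s mod n"
    have rot: "rotate s e' = rotate r e'" unfolding r_def using len' by (metis rotate_conv_mod)
    have rn: "r < n" using l by (simp add: r_def)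
    \<comment> \<open>The rotation starts inside \<open>c\<close>, exactly at the final zeros, or
      strictly inside them. The middle case gives the necklace itself; the other two are strictly
      larger.\<close>
    consider "r < length c" | "r = length c" | "r > length c" by linarith
    then show ?thesis
    proof cases
      case 1
      \<comment> \<open>Either the window of length \<open>l\<close> at \<open>r\<close> lies inside
        \<open>c\<close>, where \<open>e\<close> and \<open>e'\<close> agree and \<open>e\<close>
        has no run of \<open>l\<close> zeros, or it reaches the nonzero last letter of
        \<open>c\<close>.\<close>
      have "\<exists>t<l. r + t < length c \<and> e' ! (r + t) \<noteq> 0"
      proof (cases "r + l \<le> length c")
        case True
        then have "\<exists>t<l. e ! (r + t) \<noteq> 0"
          using R_no_longer_zero_run[of b j k n l r] e(1) b \<open>j < l\<close> cn by simp
        then show ?thesis using True nth_c by fastforce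
      next
        case False
        have "e' ! (length c - 1) \<noteq> 0"
          using c by (simp add: e'_def nth_append last_conv_nth)
        then show ?thesis using False 1 by (intro exI[of _ "length c - 1 - r"]) auto
      qed
      then obtain t where t: "t < l" "r + t < length c" "e' ! (r + t) \<noteq> 0" by blast
      then have "replicate j' 0 @ c < rotate r e'"
        using cn len' by (intro zeros_append_less[of t]) (auto simp: nth_rotate j'_def add.commute)
      then show ?thesis using rot by simp
    next
      case 2
      then show ?thesis using rot by (simp add: e'_def rotate_append)
    next
      case 3
      have "e' ! 0 \<noteq> 0" using c by (simp add: e'_def nth_append hd_conv_nth)
      \<comment> \<open>This rotation has only \<open>n - r < j'\<close> zeros before the nonzero
        first letter of \<open>c\<close>.\<close>
      then have "replicate j' 0 @ c < rotate r e'"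
        using cn len' 3 rn
        by (intro zeros_append_less[of "n - r"]) (auto simp: nth_rotate c)
      then show ?thesis using rot by simp
    qed
  qed
  then show ?thesis
    using R_append_zeros_iff[OF c(2-4), of j' k n] str unfolding e' e'_def by blast
qed

text \<open>Each of the two necklaces is a rotation of the other string, so each is at most the
  other and they coincide. Their number of leading zeros then recovers where the representatives
  were cut.\<close>

lemma R_eq_if_rotate_eq:
  assumes "2 \<le> k" "x \<in> R k n" "y \<in> R k n" "rotate i x = rotate i' y"
  shows "x = y"
proof -
  have sets: "set x = set y" using assms(4) by (metis set_rotate)
  have len: "length x = n" "length y = n"
    using R_strings[OF assms(1)] assms(2,3) by (auto simp: strings_def)
  have zero: "x = y" if "x \<in> R k n" "y \<in> R k n" "x = replicate n 0" "set x = set y" "length y = n" for x y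
  proof (cases "n = 0")
    case False
    then have "set y = {0}" using that by simp
    then show ?thesis using that by (metis replicate_eqI singletonD)
  qed (use that in simp)
  show ?thesis
  proof (cases "x = replicate n 0 \<or> y = replicate n 0")
    case True
    then show ?thesis using zero[of x y] zero[of y x] assms sets len by metis
  next
    case False
    then have "x \<noteq> []" "hd x \<noteq> 0" "y \<noteq> []" "hd y \<noteq> 0" using R_cases assms by blast+
    note nz = this
    obtain b j where b: "x = b @ replicate j 0" "b \<noteq> []" "hd b \<noteq> 0" "last b \<noteq> 0"
      using trailing_zeros_decomp[OF nz(1,2)] by blast
    obtain c l where c: "y = c @ replicate l 0" "c \<noteq> []" "hd c \<noteq> 0" "last c \<noteq> 0"
      using trailing_zeros_decomp[OF nz(3,4)] by blast
    have bx: "\<forall>i. replicate j 0 @ b \<le> rotate i x" and cy: "\<forall>i. replicate l 0 @ c \<le> rotate i y"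
      using assms(2,3) R_append_zeros_iff[OF b(2-4), of j k n] R_append_zeros_iff[OF c(2-4), of l k n]
      unfolding b(1) c(1) by simp_all
    have rot: "rotate (length b) x = replicate j 0 @ b" "rotate (length c) y = replicate l 0 @ c"
      by (simp_all add: b c rotate_append)
    obtain s where "rotate s x = replicate l 0 @ c"
      using rotate_conjugate[OF assms(4), of "length c"] rot(2) by auto
    moreover obtain s' where "rotate s' y = replicate j 0 @ b"
      using rotate_conjugate[OF assms(4)[symmetric], of "length b"] rot(1) by auto
    ultimately have eq: "replicate j 0 @ b = replicate l 0 @ c"
      using bx[rule_format, of s] cy[rule_format, of s'] by simp
    have "takeWhile (\<lambda>a. a = 0) (replicate j 0 @ b) = replicate j 0"
      "takeWhile (\<lambda>a. a = 0) (replicate l 0 @ c) = replicate l 0"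
      using b c by (auto simp: takeWhile_append takeWhile_eq_Nil_iff)
    then have "j = l" using eq by (metis length_replicate)
    then show ?thesis using eq b c by simp
  qed
qed

section \<open>Final zeros and the periodic reduction\<close>

lemma drop_eq_take_if_rotate:
  assumes "rotate p x = x" "p \<le> length x"
  shows "drop p x = take (length x - p) x"
proof (cases "p = length x")
  case False
  then have "drop p x @ take p x = x" using assms by (simp add: rotate_drop_take)
  then have "take (length x - p) (drop p x @ take p x) = take (length x - p) x" by simp
  then show ?thesis by simp
qed simp

text \<open>The last period of \<open>x\<close> begins with the nonzero letter \<open>hd x\<close>,
  so it cannot lie within the final zeros.\<close>

lemma trailing_zeros_less_period:
  fixes b :: "nat list"
  assumes "x = b @ [c] @ replicate j 0" "hd x \<noteq> 0"
  shows "j < period x"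
proof (rule ccontr)
  assume "\<not> j < period x"
  moreover have ne: "x \<noteq> []" using assms by simp
  have "0 < period x" using period_props(1)[OF ne] .
  ultimately have "length x - period x = Suc (length b) + (j - period x)" and "j - period x < j"
    using arg_cong[OF assms(1), of length] by auto
  then have "x ! (length x - period x) = (replicate j 0) ! (j - period x)"
    using nth_append_length_plus[of "b @ [c]" "replicate j 0" "j - period x"]
    by (subst assms(1)) (metis append_assoc length_append_singleton)
  then have "x ! (length x - period x) = 0" using \<open>j - period x < j\<close> by simp
  moreover have "rotate (period x) x ! (length x - period x) = x ! 0"
    using ne \<open>0 < period x\<close> period_le_length[OF ne] by (simp add: nth_rotate)
  ultimately show False using assms(2) ne by (simp add: rotate_period hd_conv_nth)
qed

lemma suffix_pr:
  assumes "x \<noteq> []"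
  shows "suffix (pr x) x"
proof -
  obtain r where r: "length x = period x * r" using period_props(2)[OF assms] by auto
  then obtain s where "r = Suc s" using assms by (cases r) auto
  then have "length x div period x = Suc s" using r period_props(1)[OF assms] by simp
  then have "x = concat (replicate s (pr x) @ [pr x])"
    using period_props(3)[OF assms] by (simp add: replicate_append_same)
  also have "\<dots> = concat (replicate s (pr x)) @ pr x" by simp
  finally show ?thesis by (rule suffixI)
qed

text \<open>Only \<open>pr x\<close> is written into the concatenation, yet all final zeros of
  \<open>x\<close> remain visible there: otherwise \<open>pr x\<close> would consist of zeros,
  against \<open>hd x\<close>.\<close>

lemma zeros_suffix_pr:
  assumes "x \<noteq> []" "hd x \<noteq> (0::nat)" "suffix (replicate l 0) x"
  shows "suffix (replicate l 0) (pr x)"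
proof (cases "l \<le> length (pr x)")
  case True
  then show ?thesis
    using suffix_length_suffix[OF assms(3) suffix_pr[OF assms(1)]] by simp
next
  case False
  then have "suffix (pr x) (replicate l 0)"
    using suffix_length_suffix[OF suffix_pr[OF assms(1)] assms(3)] by simp
  then have "set (pr x) \<subseteq> {0}" using set_mono_suffix by fastforce
  moreover have "hd (pr x) = hd x" "pr x \<noteq> []"
    using assms(1) period_props(1)[OF assms(1)] by (auto simp: pr_def)
  ultimately show ?thesis using assms(2) hd_in_set by fastforce
qed

lemma pr_zeros:
  assumes "0 < n"
  shows "pr (replicate n (0::nat)) = [0]"
proof -
  let ?z = "replicate n (0::nat)"
  have ne: "?z \<noteq> []" using assms by simp
  have "rotate 1 ?z = ?z" by simp
  then have "period ?z \<le> 1" using ne by (intro period_le_if_rotate) auto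
  then have "period ?z = 1" using period_props(1)[OF ne] by linarith
  then show ?thesis using assms by (cases n) (simp_all add: pr_def)
qed

text \<open>Doubling \<open>u\<close> turns cyclic occurrences into plain ones; the start of the
  occurrence is then reduced modulo \<open>length u\<close>.\<close>

lemma window_if_sublist:
  assumes "sublist w (u @ u)" "length w = n" "n \<le> length u" "0 < n"
  shows "\<exists>i<length u. window n u i = w"
proof -
  obtain ps ss where uu: "u @ u = ps @ w @ ss" using assms(1) by (auto simp: sublist_def)
  let ?i = "length ps mod length u"
  have len: "2 * length u = length ps + n + length ss"
    using arg_cong[OF uu, of length] assms(2) by simp
  have uu_nth: "(u @ u) ! t = u ! (t mod length u)" if "t < 2 * length u" for t
    using that by (cases "t < length u") (simp_all add: nth_append le_mod_geq)
  have "window n u ?i = w"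
  proof (rule nth_equalityI)
    fix t assume "t < length (window n u ?i)"
    then have t: "t < n" by (simp add: window_def)
    then have "window n u ?i ! t = u ! ((length ps + t) mod length u)"
      by (simp add: window_def mod_simps)
    also have "\<dots> = (u @ u) ! (length ps + t)" using t len by (intro uu_nth[symmetric]) simp
    also have "\<dots> = w ! t" unfolding uu using t assms(2) by (simp add: nth_append)
    finally show "window n u ?i ! t = w ! t" .
  qed (simp add: window_def assms(2))
  moreover have "?i < length u" using assms(3,4) by (intro mod_less_divisor) linarith
  ultimately show ?thesis by blast
qed

section \<open>The concatenation\<close>

text \<open>A tail of the reverse lexicographic listing is described as a strictly decreasing list
  that is downward closed in \<open>R k n\<close>. This is what makes neighbours in the list
  neighbours in \<open>R k n\<close>.\<close>

locale revlex_tail =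
  fixes k n :: nat and \<alpha>s :: "nat list list"
  assumes k: "2 \<le> k" and n: "2 \<le> n" and len: "2 \<le> length \<alpha>s"
    and sorted: "sorted_wrt (>) \<alpha>s"
    and in_R: "set \<alpha>s \<subseteq> R k n"
    and down_closed: "\<And>x y. y \<in> set \<alpha>s \<Longrightarrow> x \<in> R k n \<Longrightarrow> x < y \<Longrightarrow> x \<in> set \<alpha>s"
begin

lemma length_elem: "x \<in> set \<alpha>s \<Longrightarrow> length x = n"
  using in_R R_strings[OF k] by (auto simp: strings_def)

lemma elem_not_Nil: "x \<in> set \<alpha>s \<Longrightarrow> x \<noteq> []"
  using length_elem n by fastforce

lemma elem_cases: "x \<in> set \<alpha>s \<Longrightarrow> x = replicate n 0 \<or> hd x \<noteq> 0"
  using in_R R_cases by blast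

lemma hd_zeros: "hd (replicate n (0::nat)) = 0"
  using n by (cases n) auto

lemma consecutive:
  assumes "\<alpha>s = as @ x # y # bs"
  shows "y < x" "z \<in> R k n \<Longrightarrow> z < x \<Longrightarrow> z \<le> y"
proof -
  show "y < x" using sorted assms by (simp add: sorted_wrt_append)
  assume z: "z \<in> R k n" "z < x"
  then have "z \<in> set \<alpha>s" using down_closed assms by auto
  then show "z \<le> y" using sorted assms z by (auto simp: sorted_wrt_append)
qed

text \<open>\<open>0^n\<close> is the least element of \<open>R k n\<close>, so downward closure
  puts it into the list and the order puts it last.\<close>

lemma last_zeros: "\<exists>as x. \<alpha>s = as @ [x, replicate n 0]"
proof -
  obtain bs z where bz: "\<alpha>s = bs @ [z]" using len by (cases \<alpha>s rule: rev_cases) auto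
  obtain as x where ax: "bs = as @ [x]" using len bz by (cases bs rule: rev_cases) auto
  have "z = replicate n 0"
  proof (rule ccontr)
    assume "z \<noteq> replicate n 0"
    then have z: "hd z \<noteq> 0" "z \<noteq> []" using elem_cases[of z] elem_not_Nil[of z] bz by auto
    have "replicate n 0 < z"
      using zeros_append_less[of 0 n z "[]"] z n by (simp add: hd_conv_nth)
    moreover have "replicate n 0 \<in> R k n" by (simp add: R_def)
    ultimately have "replicate n 0 \<in> set \<alpha>s" using down_closed[of z] bz by auto
    with \<open>replicate n 0 < z\<close> show False using sorted bz by (auto simp: sorted_wrt_append)
  qed
  then show ?thesis using bz ax by auto
qed

text \<open>The next representative is at least the string obtained from \<open>x\<close> by zeroing its last
  nonzero letter.\<close>

lemma common_prefix:
  assumes "\<alpha>s = as @ x # y # bs" "x = b @ [c] @ replicate j 0" "c \<noteq> 0" "hd x \<noteq> 0"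
  shows "prefix b y"
proof (cases "b = []")
  case False
  have lx: "length x = n" "length y = n" using length_elem assms(1) by auto
  have nj: "n - Suc j = length b" using lx assms(2) by simp
  \<comment> \<open>Overwriting the last \<open>Suc j\<close> letters changes only \<open>c\<close>.
    The resulting representative is below \<open>x\<close>, hence at most \<open>y\<close>, and
    \<open>y\<close> is caught between two strings with prefix \<open>b\<close>.\<close>
  have "drop (n - Suc j) x \<noteq> replicate (Suc j) 0" using assms(2,3) nj by simp
  moreover have "Suc j < n" using lx assms(2) False by (cases b) auto
  moreover have "x \<in> R k n" using in_R assms(1) by auto
  ultimately have "take (n - Suc j) x @ replicate (Suc j) 0 \<in> R k n"
    using R_overwrite_zeros[OF k _ assms(4)] by blast
  then have z: "b @ replicate (Suc j) 0 \<in> R k n" using nj assms(2) by simp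
  have "b @ replicate (Suc j) 0 < x"
    using assms(2,3) append_less_append_iff[of b b "replicate (Suc j) 0" "[c] @ replicate j 0"] by simp
  then have "b @ replicate (Suc j) 0 \<le> y" using consecutive(2)[OF assms(1) z] by simp
  moreover have "y \<le> b @ ([c] @ replicate j 0)" using consecutive(1)[OF assms(1)] assms(2) by simp
  moreover have "length y = length b + (n - length b)" using lx assms(2) by simp
  ultimately show ?thesis by (rule prefix_if_between)
qed simp

section \<open>Where prefixes and rotations appear in the concatenation\<close>

lemma last_nonzero_decomp:
  assumes "x \<in> set \<alpha>s" "hd x \<noteq> 0"
  obtains b c j where "x = b @ [c] @ replicate j 0" "c \<noteq> 0"
proof -
  obtain b j where b: "x = b @ replicate j 0" "b \<noteq> []" "hd b \<noteq> 0" "last b \<noteq> 0"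
    using trailing_zeros_decomp[OF elem_not_Nil[OF assms(1)] assms(2)] by blast
  then have "x = butlast b @ [last b] @ replicate j 0" by simp
  then show ?thesis using that b(4) by blast
qed

text \<open>Backward induction: if \<open>x\<close> is periodic, then its successor agrees with \<open>x\<close> on all but the
  last period.\<close>

lemma prefix_UC:
  assumes "\<alpha>s = as @ x # bs" "hd x \<noteq> 0"
  shows "prefix x (UC (x # bs))"
  using assms
proof (induction bs arbitrary: as x)
  case Nil
  \<comment> \<open>This case is void: the last string is \<open>0^n\<close>, whose first letter is
    zero.\<close>
  then show ?case using last_zeros hd_zeros by auto
next
  case (Cons y bs)
  have x: "x \<in> set \<alpha>s" using Cons.prems by simp
  have ne: "x \<noteq> []" and lx: "length x = n" using elem_not_Nil[OF x] length_elem[OF x] .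
  let ?p = "period x"
  have UC: "UC (x # y # bs) = take ?p x @ UC (y # bs)" by (simp add: UC_def pr_def)
  have "prefix (drop ?p x) (UC (y # bs))"
  proof (cases "?p = n")
    case False
    then have p: "?p < n" using period_le_length[OF ne] lx by simp
    obtain b c j where b: "x = b @ [c] @ replicate j 0" "c \<noteq> 0"
      using last_nonzero_decomp[OF x Cons.prems(2)] by blast
    have jp: "j < ?p" using trailing_zeros_less_period[OF b(1) Cons.prems(2)] .
    have "length b = n - Suc j" using b(1) lx by simp
    \<comment> \<open>The final zeros are shorter than the period, so the first
      \<open>n - ?p\<close> letters of \<open>x\<close> already lie in \<open>b\<close>, which
      \<open>x\<close> shares with \<open>y\<close>.\<close>
    then have lb: "n - ?p \<le> length b" "b \<noteq> []" using jp p by auto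
    have b_y: "prefix b y" using common_prefix[OF Cons.prems(1) b Cons.prems(2)] .
    then have "hd y = hd x" using lb(2) b(1) by (auto simp: prefix_def)
    then have "prefix y (UC (y # bs))"
      using Cons.IH[of "as @ [x]" y] Cons.prems by simp
    then have "prefix b (UC (y # bs))" using b_y prefix_order.trans by blast
    moreover have "drop ?p x = take (n - ?p) b"
      using drop_eq_take_if_rotate[OF rotate_period[OF ne]] p lx lb(1) b(1) by simp
    ultimately show ?thesis by (metis take_is_prefix prefix_order.trans)
  qed (simp add: lx)
  then show ?case unfolding UC by (metis append_take_drop_id same_prefix_prefix)
qed

text \<open>The block before the last one ends in \<open>n - 1\<close> zeros, and the block of
  \<open>0^n\<close> contributes one more.\<close>

lemma zeros_suffix_UC: "suffix (replicate n 0) (UC \<alpha>s)"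
proof -
  obtain as x where ax: "\<alpha>s = as @ [x, replicate n 0]" using last_zeros by blast
  have x: "x \<in> set \<alpha>s" using ax by simp
  obtain n' where n': "n = Suc n'" "n' > 0" using n by (cases n) auto
  have "replicate n 0 < x" using consecutive(1)[of as x "replicate n 0" "[]"] ax by simp
  then have hx: "hd x \<noteq> 0" using elem_cases[OF x] by auto
  have zx: "suffix (replicate n' 0) x"
  proof (rule ccontr)
    assume nsuf: "\<not> suffix (replicate n' 0) x"
    obtain a x' where ax': "x = a # x'" using elem_not_Nil[OF x] by (cases x) auto
    have "drop (n - n') x \<noteq> replicate n' 0"
      using nsuf suffix_drop by metis
    \<comment> \<open>Since \<open>n - n' = 1\<close>, this representative is the first letter of
      \<open>x\<close> followed by zeros. It would lie strictly between \<open>0^n\<close> and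
      \<open>x\<close>.\<close>
    then have mem: "take (n - n') x @ replicate n' 0 \<in> R k n" and ne: "x' \<noteq> replicate n' 0"
      using R_overwrite_zeros[OF k _ hx, of n n'] in_R x n' ax' by auto
    have "replicate n' 0 < x'"
    proof -
      have lx': "length x' = n'" using length_elem[OF x] ax' n' by simp
      then have "\<exists>t<n'. x' ! t \<noteq> 0" using ne by (metis length_replicate nth_equalityI nth_replicate)
      then show ?thesis using zeros_append_less[of _ n' x' "[]"] lx' by auto
    qed
    then have "a # replicate n' 0 < x" using ax' by simp
    then have "a # replicate n' 0 \<le> replicate n 0"
      using consecutive(2)[of as x "replicate n 0" "[]" "a # replicate n' 0"] ax mem ax' n' by simp
    then show False using hx ax' n' by simp
  qed
  obtain w where w: "pr x = w @ replicate n' 0"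
    using zeros_suffix_pr[OF elem_not_Nil[OF x] hx zx] by (auto simp: suffix_def)
  have "UC \<alpha>s = (concat (map pr as) @ w) @ replicate n' 0 @ [0]"
    using ax w pr_zeros[of n] n by (simp add: UC_def)
  also have "replicate n' 0 @ [0] = replicate n (0::nat)" using n' by (simp add: replicate_append_same)
  finally show ?thesis by (metis suffixI)
qed

text \<open>This covers the rotations that start inside the final zeros. The first \<open>y\<close>
  with prefix \<open>?q\<close> has a predecessor \<open>e\<close> without it, so \<open>e\<close>
  is already larger than \<open>y\<close> on the first \<open>n - l\<close> letters. Zeroing the
  last \<open>l\<close> letters of \<open>e\<close> keeps it above \<open>y\<close>; as no
  representative lies strictly between, \<open>e\<close> must end in these zeros already.\<close>

lemma zeros_then_prefix_occurs:
  assumes "x \<in> set \<alpha>s" "hd x \<noteq> 0" "suffix (replicate l 0) x" "l < n"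
  shows "sublist (replicate l 0 @ take (n - l) x) (UC \<alpha>s @ UC \<alpha>s)"
proof -
  let ?q = "take (n - l) x"
  have "\<exists>z\<in>set \<alpha>s. prefix ?q z" using assms(1) take_is_prefix by blast
  from split_list_first_prop[OF this] obtain as y bs
    where ys: "\<alpha>s = as @ y # bs" "prefix ?q y" "\<forall>z\<in>set as. \<not> prefix ?q z" by blast
  have q: "?q \<noteq> []" "hd ?q \<noteq> 0" using assms elem_not_Nil[OF assms(1)] by auto
  then have "hd y \<noteq> 0" using ys(2) by (auto simp: prefix_def)
  then have "prefix ?q (UC (y # bs))" using prefix_UC[OF ys(1)] ys(2) prefix_order.trans by blast
  then obtain v where v: "UC (y # bs) = ?q @ v" by (auto simp: prefix_def)
  have UC: "UC \<alpha>s = UC as @ ?q @ v" using v by (simp add: ys(1) UC_def)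
  show ?thesis
  proof (cases as rule: rev_cases)
    \<comment> \<open>The prefix \<open>?q\<close> opens the whole string, so the zeros before it
      come from the end of the preceding copy.\<close>
    case Nil
    have "suffix (replicate l 0) (replicate n (0::nat))"
      using assms(4) by (intro suffixI[of _ "replicate (n - l) 0"]) (simp add: replicate_add[symmetric])
    then have "suffix (replicate l 0) (UC \<alpha>s)"
      using zeros_suffix_UC by (rule suffix_order.trans)
    then obtain u where "UC \<alpha>s = u @ replicate l 0" by (auto simp: suffix_def)
    then have "UC \<alpha>s @ UC \<alpha>s = u @ (replicate l 0 @ ?q) @ v"
      using UC Nil by (simp add: UC_def)
    then show ?thesis by (metis sublist_appendI)
  next
    case (snoc as' e)
    have e: "e \<in> set \<alpha>s" and y: "y \<in> set \<alpha>s" using ys snoc by auto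
    have ye: "\<alpha>s = as' @ e # y # bs" using ys snoc by simp
    have "y < e" using consecutive(1)[OF ye] .
    then have he: "hd e \<noteq> 0"
    proof -
      have "replicate n 0 < y"
        using zeros_append_less[of 0 n y "[]"] \<open>hd y \<noteq> 0\<close> n elem_not_Nil[OF y] by (simp add: hd_conv_nth)
      then show ?thesis using \<open>y < e\<close> elem_cases[OF e] by auto
    qed
    have "suffix (replicate l 0) e"
    proof (rule ccontr)
      assume "\<not> ?thesis"
      then have nz: "drop (n - l) e \<noteq> replicate l 0" by (metis suffix_drop)
      let ?e' = "take (n - l) e @ replicate l 0"
      have mem: "?e' \<in> R k n"
        using R_overwrite_zeros[OF k _ he assms(4) nz] in_R e by auto
      have le: "length e = n" "length y = n" "length x = n" using length_elem e y assms(1) by auto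
      have e_split: "e = take (n - l) e @ drop (n - l) e" by simp
      have y_split: "y = ?q @ drop (n - l) y"
        using ys(2) le by (auto simp: prefix_def)
      have "replicate l 0 < drop (n - l) e"
      proof -
        have ld: "length (drop (n - l) e) = l" using le assms(4) by simp
        then have "\<exists>t<l. drop (n - l) e ! t \<noteq> 0"
          using nz by (metis length_replicate nth_equalityI nth_replicate)
        then show ?thesis using zeros_append_less[of _ l "drop (n - l) e" "[]"] ld by auto
      qed
      then have "?e' < e"
        using e_split append_less_append_iff[of "take (n - l) e" "take (n - l) e"] by metis
      then have "?e' \<le> y" using consecutive(2)[OF ye mem] by simp
      have lq: "length ?q = length (take (n - l) e)" using le by simp
      have "?q < take (n - l) e \<or> ?q = take (n - l) e"
        using \<open>y < e\<close> append_less_append_iff[OF lq] e_split y_split by metis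
      moreover have "?q \<noteq> take (n - l) e"
        using ys(3) snoc take_is_prefix[of "n - l" e] by auto
      ultimately have "y < ?e'" using append_less_append_iff[OF lq] y_split by metis
      with \<open>?e' \<le> y\<close> show False by simp
    qed
    then obtain w where "pr e = w @ replicate l 0"
      using zeros_suffix_pr[OF elem_not_Nil[OF e] he] by (auto simp: suffix_def)
    then have "UC \<alpha>s @ UC \<alpha>s = (UC as' @ w) @ (replicate l 0 @ ?q) @ v @ UC \<alpha>s"
      using UC snoc by (simp add: UC_def)
    then show ?thesis by (metis sublist_appendI)
  qed
qed

lemma rotation_occurs:
  assumes "x \<in> set \<alpha>s" "i < period x"
  shows "sublist (rotate i x) (UC \<alpha>s @ UC \<alpha>s)"
proof (cases "hd x = 0")
  case True
  then have "x = replicate n 0" using elem_cases[OF assms(1)] by auto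
  then have "rotate i x = replicate n 0" for i by (induction i) simp_all
  then show ?thesis using zeros_suffix_UC by (auto simp: suffix_def)
next
  case hx: False
  have ne: "x \<noteq> []" and lx: "length x = n" using elem_not_Nil length_elem assms(1) by auto
  obtain b c j where b: "x = b @ [c] @ replicate j 0" "c \<noteq> 0"
    using last_nonzero_decomp[OF assms(1) hx] by blast
  have jp: "j < period x" using trailing_zeros_less_period[OF b(1) hx] .
  have pn: "period x \<le> n" using period_le_length[OF ne] lx by simp
  have rot: "rotate (period x) x = x" using rotate_period[OF ne] .
  show ?thesis
  \<comment> \<open>The first period of \<open>x\<close> followed by \<open>b\<close> has
    \<open>period x + n - Suc j\<close> letters, so a window of length \<open>n\<close> at
    \<open>i\<close> fits into it exactly when \<open>i + j < period x\<close>. Otherwise the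
    rotation starts inside the final zeros.\<close>
  proof (cases "i + j < period x")
    case True
    obtain as bs where "\<alpha>s = as @ x # bs" using split_list[OF assms(1)] by blast
    moreover from this have "bs \<noteq> []" using last_zeros hx hd_zeros by auto
    ultimately obtain y cs where ys: "\<alpha>s = as @ x # y # cs" by (cases bs) auto
    have b_y: "prefix b y" using common_prefix[OF ys b hx] .
    have "prefix b (UC (y # cs))"
    proof (cases "b = []")
      case False
      then have "hd y \<noteq> 0" using b_y hx b(1) by (auto simp: prefix_def)
      then show ?thesis using prefix_UC[of "as @ [x]" y cs] ys b_y prefix_order.trans[of b y] by simp
    qed simp
    then obtain v where "UC (y # cs) = b @ v" by (auto simp: prefix_def)
    then have UC: "UC \<alpha>s = UC as @ take (period x) x @ b @ v"
      by (simp add: ys UC_def pr_def)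
    have lb: "length b = n - Suc j" using b(1) lx by simp
    have xx: "take (period x) x @ x = x @ take (period x) x"
    proof -
      have "take (period x) x @ x = take (period x) x @ drop (period x) x @ take (period x) x"
        using rot pn lx by (cases "period x = n") (simp_all add: rotate_drop_take)
      then show ?thesis by (simp only: append_assoc[symmetric] append_take_drop_id)
    qed
    have i: "i \<le> period x" "i < n" using True pn by auto
    \<comment> \<open>Up to the length of the left side, the text agrees with \<open>x\<close>
      followed by its own first period, where rotations by at most \<open>period x\<close> are plain
      substrings.\<close>
    have "take (period x) x @ b = take (period x + length b) (x @ take (period x) x)"
    proof -
      have "take (length b) x = b" using b(1) by simp
      then show ?thesis using pn lx by (simp add: xx[symmetric])
    qed
    then have "take n (drop i (take (period x) x @ b)) = take n (drop i (x @ take (period x) x))"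
    proof -
      have "n \<le> period x + length b - i" using True lb i(2) by simp
      then have "take n (drop i (take (period x + length b) z)) = take n (drop i z)" for z :: "nat list"
        by (simp add: drop_take)
      then show ?thesis using \<open>take (period x) x @ b = _\<close> by metis
    qed
    also have "\<dots> = rotate i x"
      using i lx by (simp add: rotate_drop_take min_def)
    finally have "take (period x) x @ b = take i (take (period x) x @ b) @ rotate i x
        @ drop n (drop i (take (period x) x @ b))"
      by (metis append_take_drop_id)
    then have "sublist (rotate i x) (take (period x) x @ b)" by (metis sublist_appendI)
    moreover have "sublist (take (period x) x @ b) (UC \<alpha>s @ UC \<alpha>s)"
      using sublist_appendI[of "take (period x) x @ b" "UC as" "v @ UC \<alpha>s"] UC by simp
    ultimately show ?thesis by (rule sublist_order.order.trans)
  next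
    case False
    \<comment> \<open>\<open>l\<close> is the number of final zeros that come first in the rotation:
      modulo the period, \<open>i\<close> is the position \<open>n - l\<close>.\<close>
    define l where "l = period x - i"
    have l: "0 < l" "l \<le> j" "l \<le> period x" using False assms(2) by (auto simp: l_def)
    have ln: "l < n" using l jp pn by simp
    obtain r where r: "n = period x * r" using period_props(2)[OF ne] lx by auto
    then obtain r' where r': "r = Suc r'" using n by (cases r) auto
    have "n - l = period x * r' + i" using r r' l assms(2) by (simp add: l_def)
    then have "(n - l) mod period x = i" using assms(2) by simp
    then have "rotate i x = rotate (n - l) x" using rotate_mod_eq[OF rot, of "n - l"] by simp
    also have "\<dots> = drop (n - l) x @ take (n - l) x"
      using ln l lx by (simp add: rotate_drop_take)
    also have "drop (n - l) x = replicate l 0"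
    proof -
      have "n - l = length (b @ [c]) + (j - l)" using arg_cong[OF b(1), of length] lx l(2) by simp
      moreover have "drop (length (b @ [c]) + (j - l)) ((b @ [c]) @ replicate j 0) = replicate l 0"
        using l(2) by (simp only: drop_append) simp
      ultimately show ?thesis using b(1) by (metis append_assoc)
    qed
    finally have eq: "rotate i x = replicate l 0 @ take (n - l) x" .
    have "suffix (replicate l 0) x" using \<open>drop (n - l) x = replicate l 0\<close> by (metis suffix_drop)
    then show ?thesis unfolding eq using zeros_then_prefix_occurs[OF assms(1) hx _ ln] by blast
  qed
qed

text \<open>Rotation classes of distinct representatives are disjoint, so the number of positions
  equals the number of strings to be covered; occurrence of every string then yields uniqueness by
  counting.\<close>

lemma UC_universal_cycle: "universal_cycle k n (\<Union>x\<in>set \<alpha>s. sub n x) (UC \<alpha>s)"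
proof -
  let ?S = "\<Union>x\<in>set \<alpha>s. sub n x" and ?u = "UC \<alpha>s"
  have sub: "sub n x = (\<lambda>i. rotate i x) ` {..<period x}" if "x \<in> set \<alpha>s" for x
    using sub_eq_rotations length_elem elem_not_Nil that by blast
  have "distinct \<alpha>s" using sorted by (induction \<alpha>s) auto
  have "card ?S = (\<Sum>x\<in>set \<alpha>s. card (sub n x))"
  proof (rule card_UN_disjoint)
    show "\<forall>x\<in>set \<alpha>s. finite (sub n x)" using sub by simp
    show "\<forall>x\<in>set \<alpha>s. \<forall>y\<in>set \<alpha>s. x \<noteq> y \<longrightarrow> sub n x \<inter> sub n y = {}"
      using R_eq_if_rotate_eq[OF k] in_R by (auto simp: sub) blast
  qed simp
  also have "\<dots> = (\<Sum>x\<in>set \<alpha>s. length (pr x))"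
    by (intro sum.cong) (simp_all add: card_sub length_elem elem_not_Nil length_pr)
  also have "\<dots> = length ?u"
    using \<open>distinct \<alpha>s\<close> by (simp add: UC_def length_concat sum_list_distinct_conv_sum_set comp_def)
  finally have card: "length ?u = card ?S" by simp
  have strs: "?S \<subseteq> strings k n"
  proof
    fix s assume "s \<in> ?S"
    then obtain x i where "x \<in> set \<alpha>s" "s = rotate i x" using sub by auto
    then show "s \<in> strings k n" using R_strings[OF k] in_R by (auto simp: strings_def)
  qed
  have "n \<le> length ?u" using suffix_length_le[OF zeros_suffix_UC] by simp
  then have occ: "\<exists>i<length ?u. window n ?u i = s" if "s \<in> ?S" for s
    using that rotation_occurs window_if_sublist[of s ?u n] strs n by (auto simp: sub length_elem)
  let ?W = "window n ?u ` {..<length ?u}"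
  have "?S \<subseteq> ?W" using occ by fastforce
  then have "card {..<length ?u} \<le> card ?W" using card_mono[of ?W ?S] card by simp
  then have "inj_on (window n ?u) {..<length ?u}"
    using card_image_le[of "{..<length ?u}" "window n ?u"] by (intro eq_card_imp_inj_on) auto
  then have "\<forall>s\<in>?S. \<exists>!i. i < length ?u \<and> window n ?u i = s"
    using occ unfolding inj_on_def by (metis lessThan_iff)
  moreover have "?S \<noteq> {}"
    using \<open>n \<le> length ?u\<close> n card by (metis card.empty le_zero_eq not_numeral_le_zero)
  ultimately show ?thesis unfolding universal_cycle_def using strs card by blast
qed

end

section \<open>From the last strings of the listing to the locale\<close>

lemma finite_R: "finite (R k n)"
proof -
  have "R k n \<subseteq> insert (replicate n 0) (strings k n)" by (auto simp: R_def)
  moreover have "finite (strings k n)" by (simp add: strings_eq)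
  ultimately show ?thesis by (meson finite_insert finite_subset)
qed

theorem theorem4:
  fixes k n m :: nat and \<alpha>s :: "nat list list"
  assumes "k \<ge> 2" and "n \<ge> 2" and "2 \<le> m" and "m \<le> card (R k n)"
    and "\<alpha>s = drop (card (R k n) - m) (revlex_list (R k n))"
  shows "universal_cycle k n (\<Union>i<m. sub n (\<alpha>s ! i)) (UC \<alpha>s)"
proof -
  let ?L = "revlex_list (R k n)" and ?d = "card (R k n) - m"
  have L: "set ?L = R k n" "length ?L = card (R k n)" "sorted_wrt (>) ?L"
    using finite_R[of k n] by (auto simp: revlex_list_def sorted_wrt_rev)
  have split: "?L = take ?d ?L @ \<alpha>s" using assms(5) by simp
  have m: "length \<alpha>s = m" using L(2) assms by simp
  interpret revlex_tail k n \<alpha>s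
  proof
    show "sorted_wrt (>) \<alpha>s" using L(3) split by (metis sorted_wrt_append)
    show "set \<alpha>s \<subseteq> R k n" using L(1) assms(5) by (metis set_drop_subset)
    fix x y assume xy: "y \<in> set \<alpha>s" "x \<in> R k n" "x < y"
    show "x \<in> set \<alpha>s"
    \<comment> \<open>A member of \<open>R k n\<close> outside the tail stands earlier in the
      decreasing list, hence is larger than \<open>y\<close>.\<close>
    proof (rule ccontr)
      assume "x \<notin> set \<alpha>s"
      then have "x \<in> set (take ?d ?L)" using xy(2) L(1) split by (metis Un_iff set_append)
      then have "y < x" using L(3) split xy(1) by (metis sorted_wrt_append)
      with xy(3) show False by simp
    qed
  qed (use assms m in auto)
  have "(\<Union>i<m. sub n (\<alpha>s ! i)) = (\<Union>x\<in>set \<alpha>s. sub n x)"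
    unfolding m[symmetric] by (auto simp: set_conv_nth)
  then show ?thesis using UC_universal_cycle by simp
qed

end
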